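(* Let $t$ be a positive integer with $t\equiv \mathfrak t\pmod{2730}$ for some $\mathfrak t\in\{131,1361\}$. Then $659_2^{(2;t)}=659\cdot(2^{12t}-1)/(2^{12}-1)$ is a Sierpiński number.
   Context: For integers $b\ge2$, $k\ge1$, $t\ge1$ and $z\ge0$, the $b$-repstring is $k_b^{(z;t)}=k\,(b^{(z+\ell)t}-1)/(b^{z+\ell}-1)$ where $\ell=\lfloor\log_b k\rfloor+1$ (the base-$b$ representation of $k$ repeated $t$ times with $z$ zeros inserted between consecutive copies); for $k=659$, $b=2$ one has $\ell=10$. A Sierpiński number is an odd positive integer $k$ such that $k\cdot 2^n+1$ is composite for all positive integers $n$. *)

theory Defs
  imports Complex_Main "HOL-Number_Theory.Number_Theory"
begin

definition num_digits :: "nat \<Rightarrow> nat \<Rightarrow> nat" where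
  "num_digits b k = nat \<lfloor>log (real b) (real k)\<rfloor> + 1"

text \<open>
  Intended for \<open>b \<ge> 2\<close>, \<open>k \<ge> 1\<close>, \<open>t \<ge> 1\<close>. Neither the subtractions nor the division
  on \<open>nat\<close> lose information then: the powers are at least \<open>1\<close> and
  \<open>b ^ m - 1\<close> divides \<open>b ^ (m * t) - 1\<close>.
\<close>
definition repstring :: "nat \<Rightarrow> nat \<Rightarrow> nat \<Rightarrow> nat \<Rightarrow> nat" where
  "repstring b k z t =
     k * (b ^ ((z + num_digits b k) * t) - 1) div (b ^ (z + num_digits b k) - 1)"

definition composite :: "nat \<Rightarrow> bool" where
  "composite m \<longleftrightarrow> m > 1 \<and> \<not> prime m"

definition sierpinski_number :: "nat \<Rightarrow> bool" where
  "sierpinski_number k \<longleftrightarrow> k > 0 \<and> odd k \<and> (\<forall>n>0. composite (k * 2 ^ n + 1))"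

end

theory Submission
  imports Defs
begin

text \<open>
  Write \<open>K = 659 \<cdot> (1 + 4096 + \<dots> + 4096^(t-1))\<close>. Every exponent \<open>n\<close> lies in one of
  six residue classes modulo 2, 3, 4, 8, 12, 24, the orders of 2 modulo the primes
  3, 7, 5, 17, 13, 241, and the corresponding prime divides \<open>K * 2 ^ n + 1\<close>.
  Modulo 3, 5, 7, 13 we have \<open>4096 \<equiv> 1\<close>, so \<open>K \<equiv> 659 t\<close> is determined by \<open>t\<close>
  modulo the prime; modulo 17 and 241 we have \<open>4096 \<equiv> -1\<close>, so \<open>K \<equiv> 659\<close> because \<open>t\<close> is odd.
\<close>

lemma cong_geometric_sum_1:
  fixes q m :: nat
  assumes "[q = 1] (mod m)"
  shows "[(\<Sum>i<t. q ^ i) = t] (mod m)"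
proof -
  have "[(\<Sum>i<t. q ^ i) = (\<Sum>i<t. 1 ^ i)] (mod m)"
    by (intro cong_sum cong_pow assms)
  then show ?thesis by simp
qed

text \<open>After the initial 1, consecutive terms pair up as
  \<open>q ^ (2 * s + 1) * (q + 1)\<close>, which vanishes modulo \<open>m\<close>; odd
  \<open>t\<close> leaves no term unpaired.\<close>

lemma cong_geometric_sum_minus_1:
  fixes q m :: nat
  assumes "m dvd q + 1" and "odd t"
  shows "[(\<Sum>i<t. q ^ i) = 1] (mod m)"
proof -
  obtain s where s: "t = 2 * s + 1" using \<open>odd t\<close> by (rule oddE)
  have "[(\<Sum>i<2 * s + 1. q ^ i) = 1] (mod m)"
  proof (induction s)
    case (Suc s)
    have "(\<Sum>i<2 * Suc s + 1. q ^ i) = (\<Sum>i<2 * s + 1. q ^ i) + q ^ (2 * s + 1) * (q + 1)"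
      by (simp add: algebra_simps)
    moreover have "[q ^ (2 * s + 1) * (q + 1) = 0] (mod m)"
      unfolding cong_0_iff using assms(1) by (rule dvd_mult)
    ultimately show ?case using cong_add[OF Suc] by (metis add.right_neutral)
  qed simp
  then show ?thesis by (simp add: s)
qed

lemma cong_pow_mod_exponent:
  fixes a m :: nat
  assumes "[a ^ d = 1] (mod m)"
  shows "[a ^ n = a ^ (n mod d)] (mod m)"
proof -
  have "a ^ n = (a ^ d) ^ (n div d) * a ^ (n mod d)"
    by (simp flip: power_mult power_add)
  also have "[\<dots> = 1 ^ (n div d) * a ^ (n mod d)] (mod m)"
    by (intro cong_mult cong_pow assms cong_refl)
  finally show ?thesis by simp
qed

text \<open>Reduces a whole residue class of exponents to one numerical check; \<open>d\<close> may
  be any period of the powers of \<open>a\<close>.\<close>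

lemma dvd_mult_power_add_1:
  fixes k a m :: nat
  assumes "[k = c] (mod m)" and "[a ^ d = 1] (mod m)" and "n mod d = r"
    and "m dvd c * a ^ r + 1"
  shows "m dvd k * a ^ n + 1"
proof -
  have "[k * a ^ n + 1 = c * a ^ r + 1] (mod m)"
    using cong_pow_mod_exponent[OF assms(2), of n] assms(1,3)
    by (intro cong_add cong_mult) auto
  then show ?thesis using assms(4) by (simp add: cong_dvd_iff)
qed

lemma compositeI:
  assumes "p dvd m" and "1 < p" and "p < m"
  shows "composite m"
  using assms unfolding composite_def by (auto simp: prime_nat_iff)

lemma num_digits_eq:
  assumes "b \<ge> 2" and "b ^ d \<le> k" and "k < b ^ (d + 1)"
  shows "num_digits b k = d + 1"
  using floor_log_nat_eq_if[OF assms(2,3,1)] by (simp add: num_digits_def)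

lemma repstring_eq_sum:
  assumes "b \<ge> 2"
  shows "repstring b k z t = k * (\<Sum>i<t. (b ^ (z + num_digits b k)) ^ i)"
proof -
  define q where "q = b ^ (z + num_digits b k)"
  \<comment> \<open>\<open>num_digits\<close> is at least 1 by definition, so \<open>q - 1\<close>
    is nonzero and can be cancelled.\<close>
  have "b ^ 1 \<le> q" unfolding q_def
    using assms by (intro power_increasing) (auto simp: num_digits_def)
  then have q: "q \<ge> 2" using assms by simp
  have "int (q ^ t - 1) = int ((q - 1) * (\<Sum>i<t. q ^ i))"
    using q power_diff_1_eq[of "int q" t] by (simp add: of_nat_diff)
  then have "q ^ t - 1 = (q - 1) * (\<Sum>i<t. q ^ i)"
    by (simp only: of_nat_eq_iff)
  then have "repstring b k z t = k * ((q - 1) * (\<Sum>i<t. q ^ i)) div (q - 1)"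
    by (simp add: repstring_def q_def power_mult)
  also have "\<dots> = k * (\<Sum>i<t. q ^ i)"
    using q by (simp add: mult.left_commute)
  finally show ?thesis by (simp add: q_def)
qed

text \<open>All the moduli divide 24, so a covering claim needs checking only on
  \<open>n < 24\<close>.\<close>

lemma mod_24_cases:
  fixes n :: nat
  assumes "\<forall>m\<in>{..<24::nat}. P (m mod 2) (m mod 3) (m mod 4) (m mod 8) (m mod 12) m"
  shows "P (n mod 2) (n mod 3) (n mod 4) (n mod 8) (n mod 12) (n mod 24)"
  using bspec[OF assms, of "n mod 24"] by (simp add: mod_mod_cancel)

text \<open>The residues solve \<open>659 * 131 * 2 ^ r\<close> \<equiv> -1 modulo 3, 7, 5 and 13,
  and \<open>659 * 2 ^ r\<close> \<equiv> -1 modulo 17 and 241. Replacing 131 by 1361 changes only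
  those for 7 and 13.\<close>

lemma exponent_cases_131:
  fixes n :: nat
  shows "n mod 2 = 1 \<or> n mod 3 = 2 \<or> n mod 4 = 0 \<or> n mod 8 = 6 \<or> n mod 12 = 10 \<or> n mod 24 = 18"
  by (rule mod_24_cases) (simp add: lessThan_nat_numeral)

lemma exponent_cases_1361:
  fixes n :: nat
  shows "n mod 2 = 1 \<or> n mod 3 = 1 \<or> n mod 4 = 0 \<or> n mod 8 = 6 \<or> n mod 12 = 2 \<or> n mod 24 = 18"
  by (rule mod_24_cases) (simp add: lessThan_nat_numeral)

theorem theorem4p3:
  fixes t t' :: nat
  assumes "t > 0"
    and "t' \<in> {131, 1361}"
    and "[t = t'] (mod 2730)"
  shows "real (repstring 2 659 2 t) = 659 * (2 ^ (12 * t) - 1) / (2 ^ 12 - 1)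
       \<and> sierpinski_number (repstring 2 659 2 t)"
proof -
  define K where "K = repstring 2 659 2 t"
  have "num_digits 2 659 = 10"
    using num_digits_eq[of 2 9 659] by simp
  then have K: "K = 659 * (\<Sum>i<t. 4096 ^ i)"
    by (simp add: K_def repstring_eq_sum)

  have "real K = 659 * (\<Sum>i<t. 4096 ^ i)" by (simp add: K)
  also have "\<dots> = 659 * (2 ^ (12 * t) - 1) / (2 ^ 12 - 1)"
    by (simp add: geometric_sum power_mult)
  finally have closed_form: "real K = 659 * (2 ^ (12 * t) - 1) / (2 ^ 12 - 1)" .

  \<comment> \<open>2730 = 2 * 3 * 5 * 7 * 13: the factor 2 fixes the parity of \<open>t\<close>,
    the others its residues.\<close>
  have t_cong: "[t = t'] (mod m)" if "m dvd 2730" for m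
    using assms(3) that by (rule cong_dvd_modulus_nat)
  have "odd t"
    using t_cong[of 2] assms(2) by (auto simp: cong_def odd_iff_mod_2_eq_one)

  have K_mod: "[K = 659 * t'] (mod m)" if "m dvd 2730" "[4096 = 1] (mod m)" for m
    unfolding K using cong_geometric_sum_1[OF that(2)] t_cong[OF that(1)]
    by (intro cong_mult cong_refl) (rule cong_trans)
  have K_mods: "[K = 659 * t'] (mod 3)" "[K = 659 * t'] (mod 5)" "[K = 659 * t'] (mod 7)"
      "[K = 659 * t'] (mod 13)"
    by (rule K_mod; simp add: cong_def)+
  \<comment> \<open>4097 = 17 * 241.\<close>
  have K_mod': "[K = 659 * 1] (mod m)" if "m dvd 4096 + 1" for m
    unfolding K using that \<open>odd t\<close>
    by (intro cong_mult cong_refl cong_geometric_sum_minus_1)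
  have K_mods': "[K = 659] (mod 17)" "[K = 659] (mod 241)"
    using K_mod'[of 17] K_mod'[of 241] by simp_all

  \<comment> \<open>Splitting off the first term shows \<open>K\<close> as 659 plus an even number,
    giving oddness and the lower bound.\<close>
  obtain s where "t = Suc s" using \<open>t > 0\<close> gr0_implies_Suc by blast
  then have K_Suc: "K = 659 + 659 * 4096 * (\<Sum>i<s. 4096 ^ i)"
    unfolding K by (simp add: sum.lessThan_Suc_shift sum_distrib_left del: sum.lessThan_Suc)
  have "odd K" and K_ge: "K \<ge> 659" unfolding K_Suc by simp_all

  have "composite (K * 2 ^ n + 1)" for n
  proof -
    have "\<exists>p\<in>{3, 5, 7, 13, 17, 241}. p dvd K * 2 ^ n + 1"
      using assms(2)
    proof (elim insertE emptyE)
      assume "t' = 131"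
      then show ?thesis
        \<comment> \<open>The arguments are base, period, exponent and residue; what remains is
          arithmetic on numerals.\<close>
        using exponent_cases_131[of n]
          dvd_mult_power_add_1[OF K_mods(1), of 2 2 n 1]
          dvd_mult_power_add_1[OF K_mods(3), of 2 3 n 2]
          dvd_mult_power_add_1[OF K_mods(2), of 2 4 n 0]
          dvd_mult_power_add_1[OF K_mods'(1), of 2 8 n 6]
          dvd_mult_power_add_1[OF K_mods(4), of 2 12 n 10]
          dvd_mult_power_add_1[OF K_mods'(2), of 2 24 n 18]
        by (auto simp: cong_def)
    next
      assume "t' = 1361"
      then show ?thesis
        using exponent_cases_1361[of n]
          dvd_mult_power_add_1[OF K_mods(1), of 2 2 n 1]
          dvd_mult_power_add_1[OF K_mods(3), of 2 3 n 1]
          dvd_mult_power_add_1[OF K_mods(2), of 2 4 n 0]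
          dvd_mult_power_add_1[OF K_mods'(1), of 2 8 n 6]
          dvd_mult_power_add_1[OF K_mods(4), of 2 12 n 2]
          dvd_mult_power_add_1[OF K_mods'(2), of 2 24 n 18]
        by (auto simp: cong_def)
    qed
    then obtain p where p: "p \<in> {3, 5, 7, 13, 17, 241}" "p dvd K * 2 ^ n + 1" by blast
    \<comment> \<open>The value exceeds 241, so \<open>p\<close> is a proper divisor.\<close>
    have "K * 1 \<le> K * 2 ^ n" by (intro mult_le_mono2) simp
    with K_ge have "659 \<le> K * 2 ^ n" by linarith
    with p show ?thesis by (intro compositeI[of p]) auto
  qed
  with K_ge \<open>odd K\<close> have "sierpinski_number K"
    unfolding sierpinski_number_def by simp
  with closed_form show ?thesis by (simp add: K_def)
qed

end
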